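(* Let $n\ge2$ and let $\mathcal{A}=(G,\theta)$ be the valued digraph with vertex set $\lambda_n=\{(a,b)\in[n]^2: a<b\}$, with an arc from $(a,b)$ to $(c,d)$ if and only if $(c,d)=(a,k)$ or $(c,d)=(k,b)$ for some integer $k$ with $a<k<b$, and with $\theta(a,b)=d^+(a,b)/2=b-a-1$. Then the symmetric group $S_n$ (the Coxeter group $A_{n-1}$) with the right weak order $\le_R$ is isomorphic, as a poset, to $(IS(\mathcal{A}),\subseteq)$.
   Context: Valued digraph: pair $(G,\theta)$, $G=(V,E)$ simple acyclic digraph, $\theta:V\to\mathbb{N}$ with $0\le\theta(x)\le d^+(x)$ (out-degree). A vertex $x$ is erasable if $\theta(x)=0$ and all $z$ with $(z,x)\in E$ have $\theta(z)\neq 0$. Peeling process: repeatedly choose an erasable vertex $x_i$ of the current valued digraph, delete it and its incident arcs, and decrease by $1$ the value of every $y$ having an arc $(y,x_i)$; stop when no erasable vertex exists. The sequences $[x_1,x_2,\dots]$ obtained are peeling sequences, and $IS(\mathcal{G})$ is the set of $\emptyset$ together with all sets $\{x_1,\dots,x_k\}$ ($k\ge1$) for peeling sequences. $S_n$ is generated by the simple transpositions $s_i=(i\ i+1)$, $1\le i\le n-1$, with length $\ell$; the right weak order is $w\le_R\tau$ iff $\tau=ws_{j_1}\cdots s_{j_k}$ with $\ell(\tau)=\ell(w)+k$. *)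

theory Defs
  imports "Graph_Theory.Pair_Digraph" "HOL-Combinatorics.Permutations"
begin

locale valued_digraph = digraph G
  for G :: "('a, 'b) pre_digraph" +
  fixes \<theta> :: "'a \<Rightarrow> nat"
  assumes acyclic_arcs: "acyclic (arcs_ends G)"
    and value_le_out_degree: "x \<in> verts G \<Longrightarrow> \<theta> x \<le> out_degree G x"

definition erasable :: "('a, 'b) pre_digraph \<Rightarrow> ('a \<Rightarrow> nat) \<Rightarrow> 'a \<Rightarrow> bool" where
  "erasable G \<theta> x \<longleftrightarrow> x \<in> verts G \<and> \<theta> x = 0 \<and> (\<forall>z\<in>verts G. z \<rightarrow>\<^bsub>G\<^esub> x \<longrightarrow> \<theta> z \<noteq> 0)"

text \<open>When \<open>x\<close> is erasable, every \<open>y\<close> with an arc to \<open>x\<close> has a nonzero value, so the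
  subtraction below is never truncated in a peeling process.\<close>

definition erase_value :: "('a, 'b) pre_digraph \<Rightarrow> ('a \<Rightarrow> nat) \<Rightarrow> 'a \<Rightarrow> 'a \<Rightarrow> nat" where
  "erase_value G \<theta> x = (\<lambda>y. if y \<rightarrow>\<^bsub>G\<^esub> x then \<theta> y - 1 else \<theta> y)"

text \<open>The process runs until no vertex is erasable; on a finite digraph it always ends, so
  the sequences it produces are finite lists.\<close>

inductive peeling_sequence ::
    "('a, 'b) pre_digraph \<Rightarrow> ('a \<Rightarrow> nat) \<Rightarrow> 'a list \<Rightarrow> bool" where
  stop: "(\<nexists>x. erasable G \<theta> x) \<Longrightarrow> peeling_sequence G \<theta> []"
| erase: "erasable G \<theta> x \<Longrightarrow>
    peeling_sequence (pre_digraph.del_vert G x) (erase_value G \<theta> x) xs \<Longrightarrow>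
    peeling_sequence G \<theta> (x # xs)"

definition IS :: "('a, 'b) pre_digraph \<Rightarrow> ('a \<Rightarrow> nat) \<Rightarrow> 'a set set" where
  "IS G \<theta> = insert {}
     {set (take k xs) | k xs. peeling_sequence G \<theta> xs \<and> 1 \<le> k \<and> k \<le> length xs}"

definition lambda_set :: "nat \<Rightarrow> (nat \<times> nat) set" where
  "lambda_set n = {(a, b). a \<in> {1..n} \<and> b \<in> {1..n} \<and> a < b}"

definition lambda_digraph :: "nat \<Rightarrow> (nat \<times> nat, (nat \<times> nat) \<times> (nat \<times> nat)) pre_digraph" where
  "lambda_digraph n = with_proj
     \<lparr> pverts = lambda_set n,
       parcs = {((a, b), (c, d)). (a, b) \<in> lambda_set n \<and> (c, d) \<in> lambda_set n \<and>
         (\<exists>k. a < k \<and> k < b \<and> ((c, d) = (a, k) \<or> (c, d) = (k, b)))} \<rparr>"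

definition lambda_value :: "nat \<times> nat \<Rightarrow> nat" where
  "lambda_value = (\<lambda>(a, b). b - a - 1)"

lemma lambda_out_degree:
  assumes "(a, b) \<in> lambda_set n"
  shows "out_degree (lambda_digraph n) (a, b) = 2 * lambda_value (a, b)"
proof -
  let ?L = "(\<lambda>k. ((a, b), (a, k))) ` {a<..<b}" and ?R = "(\<lambda>k. ((a, b), (k, b))) ` {a<..<b}"
  have "out_arcs (lambda_digraph n) (a, b) = ?L \<union> ?R"
    using assms by (auto simp: out_arcs_def lambda_digraph_def lambda_set_def)
  moreover have "card ?L = b - a - 1" "card ?R = b - a - 1"
    by (subst card_image; simp add: inj_on_def)+
  moreover have "?L \<inter> ?R = {}"
    by auto
  ultimately show ?thesis
    by (simp add: out_degree_def card_Un_disjoint lambda_value_def)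
qed

lemma lambda_valued_digraph: "valued_digraph (lambda_digraph n) lambda_value"
proof -
  have fin: "finite (lambda_set n)"
    by (rule finite_subset[of _ "{1..n} \<times> {1..n}"]) (auto simp: lambda_set_def)
  have fin_arcs: "finite (arcs (lambda_digraph n))"
    by (rule finite_subset[of _ "lambda_set n \<times> lambda_set n"])
      (auto simp: lambda_digraph_def fin)
  have "arcs_ends (lambda_digraph n) \<subseteq> (measure (\<lambda>(a, b). b - a))\<inverse>"
    by (auto simp: lambda_digraph_def lambda_set_def)
  then have "acyclic (arcs_ends (lambda_digraph n))"
    by (meson acyclic_converse acyclic_subset wf_acyclic wf_measure)
  moreover have "lambda_value x \<le> out_degree (lambda_digraph n) x"
    if "x \<in> verts (lambda_digraph n)" for x
    using that lambda_out_degree[of "fst x" "snd x" n] by (simp add: lambda_digraph_def)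
  moreover have "digraph (lambda_digraph n)"
    using fin fin_arcs
    by unfold_locales (auto simp: lambda_digraph_def lambda_set_def arc_to_ends_def)
  ultimately show ?thesis
    by (intro valued_digraph.intro valued_digraph_axioms.intro)
qed

definition simple_product :: "nat list \<Rightarrow> nat \<Rightarrow> nat" where
  "simple_product js = foldr (\<lambda>j w. transpose j (j + 1) \<circ> w) js id"

definition cox_length :: "nat \<Rightarrow> (nat \<Rightarrow> nat) \<Rightarrow> nat" where
  "cox_length n w =
     (LEAST k. \<exists>js. length js = k \<and> set js \<subseteq> {1..n - 1} \<and> simple_product js = w)"

definition right_weak_le :: "nat \<Rightarrow> (nat \<Rightarrow> nat) \<Rightarrow> (nat \<Rightarrow> nat) \<Rightarrow> bool" where
  "right_weak_le n w \<tau> \<longleftrightarrow>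
     (\<exists>js. set js \<subseteq> {1..n - 1} \<and> \<tau> = w \<circ> simple_product js \<and>
        cox_length n \<tau> = cox_length n w + length js)"

end

theory Submission
  imports Defs
begin

text \<open>
  The isomorphism sends \<open>w\<close> to its set of value inversions: the pairs \<open>a < b\<close> such that \<open>b\<close>
  precedes \<open>a\<close> in the one-line notation \<open>w 1, \<dots>, w n\<close>. Right multiplication by \<open>s\<^sub>j\<close> at an
  ascent \<open>w j < w (j + 1)\<close> adds exactly the pair \<open>(w j, w (j + 1))\<close>, and if the inversions of
  \<open>w\<close> are properly contained in those of \<open>\<tau>\<close>, some ascent of \<open>w\<close> adds an inversion of \<open>\<tau>\<close>
  (otherwise \<open>inv \<tau> \<circ> w\<close> would be increasing). Hence \<open>\<ell>\<close> counts inversions and the right weak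
  order is inclusion of inversion sets. On the other side, once the inversions of \<open>w\<close> have
  been erased, the erasable vertices are exactly the pairs \<open>(w j, w (j + 1))\<close> at ascents \<open>j\<close>,
  so that peeling walks upwards along the weak order.
\<close>

section \<open>Inversion sets, ascents and the digraphs left after erasing\<close>

definition inversions :: "nat \<Rightarrow> (nat \<Rightarrow> nat) \<Rightarrow> (nat \<times> nat) set" where
  "inversions n w = {(a, b). (a, b) \<in> lambda_set n \<and> inv w b < inv w a}"

definition ascent :: "nat \<Rightarrow> (nat \<Rightarrow> nat) \<Rightarrow> nat \<Rightarrow> bool" where
  "ascent n w j \<longleftrightarrow> 1 \<le> j \<and> j < n \<and> w j < w (j + 1)"

definition between :: "(nat \<Rightarrow> nat) \<Rightarrow> nat \<times> nat \<Rightarrow> nat set" where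
  "between w = (\<lambda>(a, b). {k. a < k \<and> k < b \<and> inv w a < inv w k \<and> inv w k < inv w b})"

text \<open>Built from the set of erased vertices alone, so the order of erasure is forgotten and
  deleting a further vertex is just an \<open>insert\<close> into \<open>I\<close>.\<close>

definition residual :: "nat \<Rightarrow> (nat \<times> nat) set \<Rightarrow> (nat \<times> nat, (nat \<times> nat) \<times> (nat \<times> nat)) pre_digraph" where
  "residual n I = \<lparr> verts = lambda_set n - I,
     arcs = {e \<in> arcs (lambda_digraph n). fst e \<notin> I \<and> snd e \<notin> I}, tail = fst, head = snd \<rparr>"

lemma finite_lambda_set: "finite (lambda_set n)"
  by (rule finite_subset[of _ "{1..n} \<times> {1..n}"]) (auto simp: lambda_set_def)

lemma inversions_subset: "inversions n w \<subseteq> lambda_set n"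
  by (auto simp: inversions_def)

lemma finite_inversions: "finite (inversions n w)"
  using finite_lambda_set inversions_subset by (rule finite_subset[rotated])

lemma inversions_id: "inversions n id = {}"
  by (auto simp: inversions_def lambda_set_def)

lemma finite_between: "finite (between w x)"
  by (rule finite_subset[of _ "{..snd x}"]) (auto simp: between_def)

section \<open>Right multiplication by a simple transposition\<close>

lemma permutes_comp_transpose:
  fixes w :: "nat \<Rightarrow> nat"
  assumes "w permutes {1..n}" "1 \<le> j" "j < n"
  shows "w \<circ> transpose j (j + 1) permutes {1..n}"
  using assms by (intro permutes_compose permutes_swap_id) auto

lemma inv_comp_transpose:
  assumes "w permutes S"
  shows "inv (w \<circ> transpose j (j + 1)) = transpose j (j + 1) \<circ> inv w"
  using assms by (simp add: o_inv_distrib permutes_bij)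

lemma ascent_in_lambda_set:
  assumes w: "w permutes {1..n}" and j: "ascent n w j"
  shows "(w j, w (j + 1)) \<in> lambda_set n"
proof -
  have "j \<in> {1..n}" "j + 1 \<in> {1..n}" "w j < w (j + 1)"
    using j by (auto simp: ascent_def)
  then show ?thesis
    using permutes_in_image[OF w] unfolding lambda_set_def by blast
qed

text \<open>Positions \<open>j\<close> and \<open>j + 1\<close> are adjacent, so every other
  position compares alike with both; swapping them reverses only the two values standing
  there.\<close>

lemma inv_ascent_less_iff:
  assumes w: "w permutes {1..n}" and j: "ascent n w j" and "a < b"
  shows "inv (w \<circ> transpose j (j + 1)) a < inv (w \<circ> transpose j (j + 1)) b \<longleftrightarrow>
    inv w a < inv w b \<and> (a, b) \<noteq> (w j, w (j + 1))"
proof -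
  have *: "inv w i = m \<longleftrightarrow> i = w m" for i m
    using permutes_inv_eq[OF w] by metis
  have ne: "inv w a \<noteq> inv w b"
    using \<open>a < b\<close> by (metis * less_irrefl)
  show ?thesis
  proof (cases "{inv w a, inv w b} = {j, j + 1}")
    case True
    then have "(a, b) = (w j, w (j + 1)) \<or> (a, b) = (w (j + 1), w j)"
      unfolding doubleton_eq_iff * by blast
    \<comment> \<open>The other order of the two values would contradict \<open>a < b\<close> at an
      ascent.\<close>
    then have "(a, b) = (w j, w (j + 1))"
      using \<open>a < b\<close> j by (auto simp: ascent_def)
    then show ?thesis
      unfolding inv_comp_transpose[OF w] using w by (simp add: permutes_inverses)
  next
    case False
    then have "(a, b) \<noteq> (w j, w (j + 1))"
      using w by (auto simp: permutes_inverses)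
    with False ne show ?thesis
      unfolding inv_comp_transpose[OF w] by (auto simp: transpose_def)
  qed
qed

lemma in_inversions_iff: "w permutes {1..n} \<Longrightarrow>
  (a, b) \<in> inversions n w \<longleftrightarrow> (a, b) \<in> lambda_set n \<and> \<not> inv w a < inv w b"
  by (auto simp: inversions_def lambda_set_def not_less le_less
      dest: injD[OF permutes_inj[OF permutes_inv]])

lemma inversions_ascent:
  assumes w: "w permutes {1..n}" and j: "ascent n w j"
  shows "inversions n (w \<circ> transpose j (j + 1)) = insert (w j, w (j + 1)) (inversions n w)"
    and "(w j, w (j + 1)) \<in> lambda_set n - inversions n w"
proof -
  note mem = ascent_in_lambda_set[OF w j]
  show "(w j, w (j + 1)) \<in> lambda_set n - inversions n w"
    using mem w by (simp add: in_inversions_iff permutes_inverses)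
  have v: "w \<circ> transpose j (j + 1) permutes {1..n}"
    using w j by (intro permutes_comp_transpose) (auto simp: ascent_def)
  have "(a, b) \<in> inversions n (w \<circ> transpose j (j + 1)) \<longleftrightarrow>
    (a, b) \<in> insert (w j, w (j + 1)) (inversions n w)" for a b
  proof (cases "(a, b) \<in> lambda_set n")
    case True
    then have "a < b"
      by (simp add: lambda_set_def)
    then show ?thesis
      unfolding insert_iff in_inversions_iff[OF v] in_inversions_iff[OF w]
        inv_ascent_less_iff[OF w j \<open>a < b\<close>] using True by blast
  next
    case False
    then show ?thesis
      using mem inversions_subset by blast
  qed
  then show "inversions n (w \<circ> transpose j (j + 1)) = insert (w j, w (j + 1)) (inversions n w)"
    by auto
qed

text \<open>If \<open>j\<close> is not an ascent of \<open>w\<close>, it is one of the product, and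
  multiplying once more gives back \<open>w\<close>; the count then drops by one.\<close>

lemma card_inversions_transpose_le:
  assumes w: "w permutes {1..n}" and j: "1 \<le> j" "j < n"
  shows "card (inversions n (w \<circ> transpose j (j + 1))) \<le> card (inversions n w) + 1"
    and "card (inversions n (w \<circ> transpose j (j + 1))) = card (inversions n w) + 1 \<Longrightarrow> ascent n w j"
proof -
  let ?v = "w \<circ> transpose j (j + 1)"
  have "card (inversions n ?v) \<le> card (inversions n w) + 1 \<and>
    (card (inversions n ?v) = card (inversions n w) + 1 \<longrightarrow> ascent n w j)"
  proof (cases "ascent n w j")
    case True
    then show ?thesis
      using inversions_ascent[OF w True] by (simp add: finite_inversions)
  next
    case False
    have v: "?v permutes {1..n}"
      using w j by (rule permutes_comp_transpose)
    have "w j \<noteq> w (j + 1)"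
      using w by (metis n_not_Suc_n Suc_eq_plus1 permutes_inverses(2))
    with False j have "ascent n ?v j"
      by (auto simp: ascent_def)
    from inversions_ascent[OF v this]
    have "inversions n w = insert (w (j + 1), w j) (inversions n ?v)"
      "(w (j + 1), w j) \<notin> inversions n ?v"
      by (simp_all add: comp_assoc)
    then show ?thesis
      by (simp add: finite_inversions)
  qed
  then show "card (inversions n ?v) \<le> card (inversions n w) + 1"
    "card (inversions n ?v) = card (inversions n w) + 1 \<Longrightarrow> ascent n w j"
    by auto
qed

section \<open>Chains of ascents below a given permutation\<close>

lemma ascending_permutation_eq_id:
  fixes u :: "nat \<Rightarrow> nat"
  assumes u: "u permutes {1..n}" and asc: "\<And>j. 1 \<le> j \<Longrightarrow> j < n \<Longrightarrow> u j < u (j + 1)"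
  shows "u = id"
proof (rule permutes_natset_ge[OF u], rule ballI)
  fix i assume "i \<in> {1..n}"
  then have "1 \<le> i" "i \<le> n" by auto
  then show "i \<le> u i"
  proof (induction i rule: dec_induct)
    case base
    then have "u 1 \<in> {1..n}"
      using u by (subst permutes_in_image) auto
    then show ?case by simp
  next
    case (step i)
    then show ?case
      using asc[of i] by simp
  qed
qed

lemma exists_ascent:
  assumes w: "w permutes {1..n}" and t: "\<tau> permutes {1..n}"
    and sub: "inversions n w \<subseteq> inversions n \<tau>" and "w \<noteq> \<tau>"
  obtains j where "ascent n w j" "inversions n (w \<circ> transpose j (j + 1)) \<subseteq> inversions n \<tau>"
proof -
  have "\<exists>j. ascent n w j \<and> (w j, w (j + 1)) \<in> inversions n \<tau>"
  proof (rule ccontr)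
    assume no: "\<not> ?thesis"
    have "inv \<tau> \<circ> w = id"
    proof (rule ascending_permutation_eq_id)
      show "inv \<tau> \<circ> w permutes {1..n}"
        using w t by (intro permutes_compose permutes_inv)
    next
      fix j assume j: "1 \<le> j" "j < n"
      have mem: "w j \<in> {1..n}" "w (j + 1) \<in> {1..n}"
        using w j by (auto simp: permutes_in_image simp del: atLeastAtMost_iff) auto
      have ne: "w j \<noteq> w (j + 1)"
        using w by (metis n_not_Suc_n Suc_eq_plus1 permutes_inverses(2))
      then have ne': "inv \<tau> (w j) \<noteq> inv \<tau> (w (j + 1))"
        using t by (metis permutes_inverses(1))
      show "(inv \<tau> \<circ> w) j < (inv \<tau> \<circ> w) (j + 1)"
      proof (cases "w j < w (j + 1)")
        case True
        then have "(w j, w (j + 1)) \<notin> inversions n \<tau>"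
          using no j by (auto simp: ascent_def)
        then show ?thesis
          using True mem ne' by (simp add: inversions_def lambda_set_def)
      next
        case False
        \<comment> \<open>A descent of \<open>w\<close> is an inversion of \<open>w\<close>, hence
          of \<open>\<tau>\<close>, so \<open>inv \<tau>\<close> reverses the two values and the
          composite still ascends.\<close>
        then have "(w (j + 1), w j) \<in> inversions n w"
          using ne mem w by (simp add: inversions_def lambda_set_def permutes_inverses)
        then show ?thesis
          using sub by (auto simp: inversions_def)
      qed
    qed
    then have "\<tau> \<circ> (inv \<tau> \<circ> w) = \<tau>"
      by simp
    then show False
      using t \<open>w \<noteq> \<tau>\<close> by (simp add: comp_assoc[symmetric] permutes_inv_o)
  qed
  then show thesis
    using that sub inversions_ascent(1)[OF w] by auto
qed

lemma inversions_inj: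
  assumes "w permutes {1..n}" "\<tau> permutes {1..n}" "inversions n w = inversions n \<tau>"
  shows "w = \<tau>"
proof (rule ccontr)
  assume "w \<noteq> \<tau>"
  then obtain j where "ascent n w j" "inversions n (w \<circ> transpose j (j + 1)) \<subseteq> inversions n \<tau>"
    using exists_ascent assms by (metis order_refl)
  then show False
    using inversions_ascent[OF assms(1)] assms(3) by blast
qed

text \<open>The number of inversions of \<open>\<tau>\<close> that \<open>w\<close> lacks decreases
  at each ascent. The rule serves both the reduced words and the peeling prefixes.\<close>

lemma ascent_chain_induct [consumes 3, case_names refl step]:
  assumes "w permutes {1..n}" "\<tau> permutes {1..n}" "inversions n w \<subseteq> inversions n \<tau>"
    and refl: "P \<tau>"
    and step: "\<And>w j. w permutes {1..n} \<Longrightarrow> ascent n w j \<Longrightarrow>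
      inversions n (w \<circ> transpose j (j + 1)) \<subseteq> inversions n \<tau> \<Longrightarrow>
      P (w \<circ> transpose j (j + 1)) \<Longrightarrow> P w"
  shows "P w"
  using assms(1,3)
proof (induction "card (inversions n \<tau> - inversions n w)" arbitrary: w rule: less_induct)
  case less
  show ?case
  proof (cases "w = \<tau>")
    case True
    then show ?thesis by (simp add: refl)
  next
    case False
    obtain j where j: "ascent n w j" "inversions n (w \<circ> transpose j (j + 1)) \<subseteq> inversions n \<tau>"
      using exists_ascent[OF less.prems(1) assms(2) less.prems(2) False] .
    have "inversions n \<tau> - inversions n (w \<circ> transpose j (j + 1)) \<subset> inversions n \<tau> - inversions n w"
      using inversions_ascent[OF less.prems(1) j(1)] j(2) by auto
    then have "card (inversions n \<tau> - inversions n (w \<circ> transpose j (j + 1)))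
        < card (inversions n \<tau> - inversions n w)"
      by (intro psubset_card_mono finite_Diff finite_inversions)
    moreover have "w \<circ> transpose j (j + 1) permutes {1..n}"
      using less.prems(1) j(1) by (intro permutes_comp_transpose) (auto simp: ascent_def)
    ultimately show ?thesis
      using less.hyps j less.prems(1) step by blast
  qed
qed

section \<open>Coxeter length and the right weak order\<close>

lemma simple_product_Cons: "w \<circ> simple_product (j # js) = (w \<circ> transpose j (j + 1)) \<circ> simple_product js"
  by (simp add: simple_product_def comp_assoc)

lemma reduced_word_exists:
  assumes "w permutes {1..n}" "\<tau> permutes {1..n}" "inversions n w \<subseteq> inversions n \<tau>"
  shows "\<exists>js. set js \<subseteq> {1..n - 1} \<and> \<tau> = w \<circ> simple_product js \<and>
    card (inversions n \<tau>) = card (inversions n w) + length js"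
  using assms
proof (induction rule: ascent_chain_induct)
  case refl
  show ?case
    by (rule exI[of _ "[]"]) (simp add: simple_product_def)
next
  case (step w j)
  then obtain js where js: "set js \<subseteq> {1..n - 1}"
    "\<tau> = (w \<circ> transpose j (j + 1)) \<circ> simple_product js"
    "card (inversions n \<tau>) = card (inversions n (w \<circ> transpose j (j + 1))) + length js"
    by blast
  moreover have "j \<in> {1..n - 1}"
    using step.hyps(2) by (auto simp: ascent_def)
  moreover have "card (inversions n (w \<circ> transpose j (j + 1))) = card (inversions n w) + 1"
    using inversions_ascent[OF step.hyps(1,2)] by (simp add: finite_inversions)
  ultimately show ?case
    by (intro exI[of _ "j # js"]) (simp only: simple_product_Cons, simp)
qed

text \<open>Each letter adds at most one inversion. If the total is attained, every letter acts at
  an ascent, so the inversion sets grow along the word.\<close>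

lemma word_inversions:
  assumes "w permutes {1..n}" "set js \<subseteq> {1..n - 1}"
  shows "card (inversions n (w \<circ> simple_product js)) \<le> card (inversions n w) + length js \<and>
    (card (inversions n (w \<circ> simple_product js)) = card (inversions n w) + length js \<longrightarrow>
      inversions n w \<subseteq> inversions n (w \<circ> simple_product js))"
  using assms
proof (induction js arbitrary: w)
  case Nil
  then show ?case by (simp add: simple_product_def)
next
  case (Cons j js)
  let ?v = "w \<circ> transpose j (j + 1)"
  have j: "1 \<le> j" "j < n"
    using Cons.prems(2) by auto
  have v: "?v permutes {1..n}"
    using Cons.prems(1) j by (rule permutes_comp_transpose)
  have "set js \<subseteq> {1..n - 1}"
    using Cons.prems(2) by simp
  note IH = Cons.IH[OF v this]
  note step = card_inversions_transpose_le[OF Cons.prems(1) j]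
  have "inversions n w \<subseteq> inversions n (?v \<circ> simple_product js)"
    if "card (inversions n (?v \<circ> simple_product js)) = card (inversions n w) + length (j # js)"
  proof -
    \<comment> \<open>The remaining letters add at most \<open>length js\<close> inversions, so the
      first one must contribute.\<close>
    have card: "card (inversions n ?v) = card (inversions n w) + 1"
      using that IH[THEN conjunct1] step(1) unfolding list.size by linarith
    then have "inversions n ?v \<subseteq> inversions n (?v \<circ> simple_product js)"
      using that IH[THEN conjunct2] unfolding list.size by linarith
    moreover have "inversions n w \<subseteq> inversions n ?v"
      unfolding inversions_ascent(1)[OF Cons.prems(1) step(2)[OF card]] by blast
    ultimately show ?thesis
      by blast
  qed
  moreover have "card (inversions n (?v \<circ> simple_product js)) \<le> card (inversions n w) + length (j # js)"
    using IH[THEN conjunct1] step(1) unfolding list.size by linarith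
  ultimately show ?case
    unfolding simple_product_Cons by blast
qed

text \<open>Both bounds come from words starting at \<open>id\<close>, which has no inversions: a
  chain of ascents attains the count, and no word can be shorter.\<close>

lemma cox_length_eq_card_inversions:
  assumes "w permutes {1..n}"
  shows "cox_length n w = card (inversions n w)"
  unfolding cox_length_def
proof (rule Least_equality)
  show "\<exists>js. length js = card (inversions n w) \<and> set js \<subseteq> {1..n - 1} \<and> simple_product js = w"
    using reduced_word_exists[OF permutes_id assms] by (auto simp: inversions_id)
next
  fix k assume "\<exists>js. length js = k \<and> set js \<subseteq> {1..n - 1} \<and> simple_product js = w"
  then show "card (inversions n w) \<le> k"
    using word_inversions[OF permutes_id] by (force simp: inversions_id)
qed

lemma right_weak_le_iff_inversions:
  assumes "w permutes {1..n}" "\<tau> permutes {1..n}"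
  shows "right_weak_le n w \<tau> \<longleftrightarrow> inversions n w \<subseteq> inversions n \<tau>"
  unfolding right_weak_le_def cox_length_eq_card_inversions[OF assms(1)]
    cox_length_eq_card_inversions[OF assms(2)]
  using word_inversions[OF assms(1)] reduced_word_exists[OF assms] by blast

section \<open>Values and erasable vertices of the residual digraphs\<close>

text \<open>Eliminates the intermediate \<open>k\<close>: read as intervals, out-neighbours are the
  proper subintervals sharing one endpoint.\<close>

lemma arc_residual_iff:
  "(a, b) \<rightarrow>\<^bsub>residual n I\<^esub> (c, d) \<longleftrightarrow>
     (a, b) \<in> lambda_set n - I \<and> (c, d) \<in> lambda_set n - I \<and> (a = c \<and> d < b \<or> d = b \<and> a < c)"
  by (force simp: residual_def arcs_ends_def arc_to_ends_def lambda_digraph_def lambda_set_def)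

lemma residual_empty: "residual n {} = lambda_digraph n"
  by (simp add: residual_def lambda_digraph_def with_proj_def)

lemma del_vert_residual: "pre_digraph.del_vert (residual n I) x = residual n (insert x I)"
  by (auto simp: pre_digraph.del_vert_def residual_def)

text \<open>The value of a remaining vertex \<open>(a, b)\<close> counts the \<open>k\<close> that lie between \<open>a\<close> and \<open>b\<close>
  both as numbers and as entries of the one-line notation of \<open>w\<close>: the other \<open>k\<close> with
  \<open>a < k < b\<close> each contribute exactly one erased out-neighbour of \<open>(a, b)\<close>.\<close>

definition values_at :: "nat \<Rightarrow> (nat \<Rightarrow> nat) \<Rightarrow> (nat \<times> nat \<Rightarrow> nat) \<Rightarrow> bool" where
  "values_at n w \<theta> \<longleftrightarrow> (\<forall>x \<in> lambda_set n - inversions n w. \<theta> x = card (between w x))"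

lemma values_at_id: "values_at n id lambda_value"
proof -
  have "between id (a, b) = {a<..<b}" for a b
    by (auto simp: between_def)
  then show ?thesis
    by (auto simp: values_at_def lambda_value_def)
qed

text \<open>Only the pair \<open>(w j, w (j + 1))\<close> changes its relative order, so a
  \<open>between\<close> set can lose only one of these two values, and only if the other is an
  endpoint. The last two claims ensure that the lost value was present.\<close>

lemma between_ascent:
  assumes w: "w permutes {1..n}" and j: "ascent n w j"
    and x: "(c, d) \<in> lambda_set n - inversions n w" "(c, d) \<noteq> (w j, w (j + 1))"
  shows "between (w \<circ> transpose j (j + 1)) (c, d) =
    between w (c, d) - {k. c = w j \<and> k = w (j + 1) \<or> d = w (j + 1) \<and> k = w j}"
    and "c = w j \<Longrightarrow> w (j + 1) < d \<Longrightarrow> w (j + 1) \<in> between w (c, d)"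
    and "d = w (j + 1) \<Longrightarrow> c < w j \<Longrightarrow> w j \<in> between w (c, d)"
proof -
  have *: "inv w i = m \<longleftrightarrow> i = w m" for i m
    using permutes_inv_eq[OF w] by metis
  have inv: "inv w (w i) = i" for i
    using w by (simp add: permutes_inverses)
  have asc: "w j < w (j + 1)"
    using j by (simp add: ascent_def)
  have cd: "c < d" "inv w c < inv w d"
    using x by (auto simp: in_inversions_iff[OF w] lambda_set_def)
  show "between (w \<circ> transpose j (j + 1)) (c, d) =
    between w (c, d) - {k. c = w j \<and> k = w (j + 1) \<or> d = w (j + 1) \<and> k = w j}"
    by (auto simp: between_def inv_ascent_less_iff[OF w j] simp del: One_nat_def add_Suc_right)
  show "w (j + 1) \<in> between w (c, d)" if "c = w j" "w (j + 1) < d"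
  proof -
    \<comment> \<open>Since \<open>d\<close> stands after position \<open>j\<close>, it then stands
      after \<open>j + 1\<close> too.\<close>
    have "inv w d \<noteq> j + 1"
      using x that by (auto simp: *)
    then show ?thesis
      using that cd asc by (simp add: between_def inv)
  qed
  show "w j \<in> between w (c, d)" if "d = w (j + 1)" "c < w j"
  proof -
    have "inv w c \<noteq> j"
      using x that by (auto simp: *)
    then show ?thesis
      using that cd asc by (simp add: between_def inv)
  qed
qed

text \<open>A remaining vertex has an arc to the erased one exactly when its \<open>between\<close>
  set loses an element, so both sides drop by one together.\<close>

lemma values_at_erase:
  assumes w: "w permutes {1..n}" and j: "ascent n w j" and vals: "values_at n w \<theta>"
  shows "values_at n (w \<circ> transpose j (j + 1))
    (erase_value (residual n (inversions n w)) \<theta> (w j, w (j + 1)))"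
  unfolding values_at_def
proof (rule ballI, clarify)
  fix c d
  assume "(c, d) \<in> lambda_set n" "(c, d) \<notin> inversions n (w \<circ> transpose j (j + 1))"
  then have x: "(c, d) \<in> lambda_set n - inversions n w" "(c, d) \<noteq> (w j, w (j + 1))"
    using inversions_ascent(1)[OF w j] by auto
  note arc = arc_residual_iff[where a = c and b = d and c = "w j" and d = "w (j + 1)"]
  have theta: "\<theta> (c, d) = card (between w (c, d))"
    using vals x by (simp add: values_at_def)
  note b = between_ascent[OF w j x]
  have arc: "(c, d) \<rightarrow>\<^bsub>residual n (inversions n w)\<^esub> (w j, w (j + 1)) \<longleftrightarrow>
      c = w j \<and> w (j + 1) < d \<or> d = w (j + 1) \<and> c < w j"
    unfolding arc_residual_iff using x(1) inversions_ascent(2)[OF w j] by blast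
  show "erase_value (residual n (inversions n w)) \<theta> (w j, w (j + 1)) (c, d) =
    card (between (w \<circ> transpose j (j + 1)) (c, d))"
  proof (cases "(c, d) \<rightarrow>\<^bsub>residual n (inversions n w)\<^esub> (w j, w (j + 1))")
    case True
    then consider "c = w j" "w (j + 1) < d" | "d = w (j + 1)" "c < w j"
      unfolding arc by blast
    then have "\<exists>k \<in> between w (c, d). between (w \<circ> transpose j (j + 1)) (c, d) = between w (c, d) - {k}"
    proof cases
      case 1
      then show ?thesis
        unfolding b(1) using b(2) by (intro bexI[of _ "w (j + 1)"]) auto
    next
      case 2
      then show ?thesis
        unfolding b(1) using b(3) by (intro bexI[of _ "w j"]) auto
    qed
    then obtain k where "k \<in> between w (c, d)"
      "between (w \<circ> transpose j (j + 1)) (c, d) = between w (c, d) - {k}"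
      by blast
    then show ?thesis
      using True by (simp only: erase_value_def theta if_True card_Diff_singleton)
  next
    case False
    then have "between (w \<circ> transpose j (j + 1)) (c, d) = between w (c, d)"
      unfolding b(1) arc using x(2) by (auto simp: between_def)
    then show ?thesis
      using False by (simp add: erase_value_def theta)
  qed
qed

text \<open>No entry stands between adjacent positions, so the value is 0. An in-neighbour shares
  one endpoint and has the other in its \<open>between\<close> set, so its value is
  positive.\<close>

lemma ascent_erasable:
  assumes w: "w permutes {1..n}" and vals: "values_at n w \<theta>" and j: "ascent n w j"
  shows "erasable (residual n (inversions n w)) \<theta> (w j, w (j + 1))"
  unfolding erasable_def
proof (intro conjI ballI impI)
  note mem = inversions_ascent(2)[OF w j]
  then show "(w j, w (j + 1)) \<in> verts (residual n (inversions n w))"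
    by (simp add: residual_def)
  have "between w (w j, w (j + 1)) = {}"
    using w by (auto simp: between_def permutes_inverses)
  with mem vals show "\<theta> (w j, w (j + 1)) = 0"
    by (simp add: values_at_def)
next
  fix z assume arc: "z \<rightarrow>\<^bsub>residual n (inversions n w)\<^esub> (w j, w (j + 1))"
  obtain c d where z: "z = (c, d)" by fastforce
  from arc have x: "(c, d) \<in> lambda_set n - inversions n w" "(c, d) \<noteq> (w j, w (j + 1))"
    and "c = w j \<and> w (j + 1) < d \<or> d = w (j + 1) \<and> c < w j"
    unfolding z arc_residual_iff by auto
  then have "between w z \<noteq> {}"
    unfolding z using between_ascent(2,3)[OF w j x] by blast
  then show "\<theta> z \<noteq> 0"
    using vals x(1) by (simp add: values_at_def z finite_between)
qed

text \<open>If some entry stood between \<open>a\<close> and \<open>b\<close> in the one-line notation, it would be numerically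
  outside \<open>[a, b]\<close>; the in-neighbour joining it to \<open>b\<close> or \<open>a\<close> has nonzero value, which yields
  another such entry numerically closer to \<open>[a, b]\<close>.\<close>

lemma erasable_imp_ascent:
  assumes w: "w permutes {1..n}" and vals: "values_at n w \<theta>"
    and er: "erasable (residual n (inversions n w)) \<theta> (a, b)"
  obtains j where "ascent n w j" "(a, b) = (w j, w (j + 1))"
proof -
  let ?G = "residual n (inversions n w)"
  have *: "inv w i = m \<longleftrightarrow> i = w m" for i m
    using permutes_inv_eq[OF w] by metis
  have mem: "(a, b) \<in> lambda_set n - inversions n w"
    using er by (simp add: erasable_def residual_def)
  then have ab: "a < b" "inv w a < inv w b" "a \<in> {1..n}" "b \<in> {1..n}"
    using w by (auto simp: in_inversions_iff lambda_set_def)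
  have "\<theta> (a, b) = 0"
    using er by (simp add: erasable_def)
  then have "between w (a, b) = {}"
    using vals mem by (simp add: values_at_def finite_between)
  then have empty: "\<not> (a < k \<and> k < b)" if "inv w a < inv w k" "inv w k < inv w b" for k
    using that by (auto simp: between_def)
  have nonempty: "between w z \<noteq> {}" if "z \<rightarrow>\<^bsub>?G\<^esub> (a, b)" for z
  proof -
    have z: "z \<in> lambda_set n - inversions n w"
      using that by (cases z) (simp add: arc_residual_iff)
    then have "\<theta> z \<noteq> 0"
      using er that by (simp add: erasable_def residual_def)
    then show ?thesis
      using vals z by (auto simp: values_at_def)
  qed
  \<comment> \<open>Needed for \<open>(a, k)\<close> and \<open>(k, b)\<close> to be vertices in the
    two inductions below.\<close>
  have range: "k \<in> {1..n}" if "inv w a < inv w k" "inv w k < inv w b" for k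
  proof -
    have "inv w a \<in> {1..n}" "inv w b \<in> {1..n}"
      using ab permutes_in_image[OF permutes_inv[OF w]] by blast+
    with that have "inv w k \<in> {1..n}"
      by auto
    then show ?thesis
      using permutes_in_image[OF permutes_inv[OF w]] by blast
  qed
  have above: "\<not> (inv w a < inv w k \<and> inv w k < inv w b)" if "b < k" for k
    using that
  proof (induction k rule: less_induct)
    case (less k)
    show ?case
    proof
      assume k: "inv w a < inv w k \<and> inv w k < inv w b"
      then have "(a, k) \<rightarrow>\<^bsub>?G\<^esub> (a, b)"
        using mem range[of k] ab less.prems w
        by (auto simp: arc_residual_iff in_inversions_iff lambda_set_def)
      then obtain m where "m \<in> between w (a, k)"
        using nonempty by blast
      then have m: "a < m" "m < k" "inv w a < inv w m" "inv w m < inv w b"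
        using k by (auto simp: between_def)
      then have "b < m"
        using empty[of m] by (metis linorder_neqE_nat less_irrefl)
      then show False
        using less.IH m by blast
    qed
  qed
  have below: "\<not> (inv w a < inv w k \<and> inv w k < inv w b)" if "k < a" for k
    using that
  \<comment> \<open>Below \<open>a\<close> the approach to the interval is upwards, so the distance
    to \<open>a\<close> is the measure.\<close>
  proof (induction "a - k" arbitrary: k rule: less_induct)
    case (less k)
    show ?case
    proof
      assume k: "inv w a < inv w k \<and> inv w k < inv w b"
      then have "(k, b) \<rightarrow>\<^bsub>?G\<^esub> (a, b)"
        using mem range[of k] ab less.prems w
        by (auto simp: arc_residual_iff in_inversions_iff lambda_set_def)
      then obtain m where "m \<in> between w (k, b)"
        using nonempty by blast
      then have m: "k < m" "m < b" "inv w a < inv w m" "inv w m < inv w b"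
        using k by (auto simp: between_def)
      then have "m < a"
        using empty[of m] by (metis linorder_neqE_nat less_irrefl)
      then show False
        using less.hyps[of m] less.prems m by (simp add: diff_less_mono2)
    qed
  qed
  have none: "\<not> (inv w a < inv w k \<and> inv w k < inv w b)" for k
    using above[of k] below[of k] empty[of k] by (metis linorder_neqE_nat less_irrefl)
  define j where "j = inv w a"
  have a: "w j = a"
    using w by (simp add: j_def permutes_inverses)
  \<comment> \<open>Otherwise the entry at position \<open>j + 1\<close> would stand strictly
    between \<open>a\<close> and \<open>b\<close>.\<close>
  have "inv w b = j + 1"
    using none[of "w (j + 1)"] ab(2) w by (simp add: j_def permutes_inverses)
  then have b: "w (j + 1) = b"
    by (simp add: *)
  have "inv w a \<in> {1..n}" "inv w b \<in> {1..n}"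
    using ab permutes_in_image[OF permutes_inv[OF w]] by blast+
  then have "ascent n w j"
    using ab(1) \<open>inv w b = j + 1\<close> a b by (auto simp: ascent_def j_def)
  then show thesis
    using that a b by blast
qed

section \<open>Peeling sequences and their prefixes\<close>

text \<open>Collects the invariant carried along a peeling: the remaining digraph and its values are
  again those of a permutation, one inversion further.\<close>

lemma erase_step:
  assumes w: "w permutes {1..n}" and vals: "values_at n w \<theta>"
    and x: "erasable (residual n (inversions n w)) \<theta> x"
  obtains v where "v permutes {1..n}" "inversions n v = insert x (inversions n w)"
    "x \<in> lambda_set n - inversions n w"
    "values_at n v (erase_value (residual n (inversions n w)) \<theta> x)"
    "pre_digraph.del_vert (residual n (inversions n w)) x = residual n (inversions n v)"
proof -
  obtain j where j: "ascent n w j" and xj: "x = (w j, w (j + 1))"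
    using erasable_imp_ascent[OF w vals] x by (metis surj_pair)
  show thesis
  proof (rule that)
    show "w \<circ> transpose j (j + 1) permutes {1..n}"
      using w j by (intro permutes_comp_transpose) (auto simp: ascent_def)
  qed (use inversions_ascent[OF w j] values_at_erase[OF w j vals] xj in
      \<open>simp_all add: del_vert_residual\<close>)
qed

text \<open>Each erasure shrinks the finite set of remaining vertices, so peeling can be run to its
  end. This completes a partial peeling to a full sequence.\<close>

lemma peeling_sequence_exists:
  assumes "w permutes {1..n}" "values_at n w \<theta>"
  shows "\<exists>xs. peeling_sequence (residual n (inversions n w)) \<theta> xs"
  using assms
proof (induction "card (lambda_set n - inversions n w)" arbitrary: w \<theta> rule: less_induct)
  case less
  show ?case
  proof (cases "\<exists>x. erasable (residual n (inversions n w)) \<theta> x")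
    case False
    then show ?thesis by (blast intro: peeling_sequence.stop)
  next
    case True
    then obtain x where x: "erasable (residual n (inversions n w)) \<theta> x" by blast
    from erase_step[OF less.prems x] obtain v where v: "v permutes {1..n}"
      "inversions n v = insert x (inversions n w)" "x \<in> lambda_set n - inversions n w"
      "values_at n v (erase_value (residual n (inversions n w)) \<theta> x)"
      "pre_digraph.del_vert (residual n (inversions n w)) x = residual n (inversions n v)" .
    have "card (lambda_set n - inversions n v) < card (lambda_set n - inversions n w)"
      using v(2,3) by (intro psubset_card_mono) (auto simp: finite_lambda_set)
    from less.hyps[OF this v(1,4)] show ?thesis
      using peeling_sequence.erase[OF x] v(5) by metis
  qed
qed

lemma peeling_prefix_inversions:
  assumes "w permutes {1..n}" "values_at n w \<theta>"
    and "peeling_sequence (residual n (inversions n w)) \<theta> xs"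
  shows "\<exists>\<tau>. \<tau> permutes {1..n} \<and> inversions n \<tau> = inversions n w \<union> set (take k xs)"
  using assms
proof (induction xs arbitrary: w \<theta> k)
  case Nil
  then show ?case by auto
next
  case (Cons x xs)
  show ?case
  proof (cases k)
    case 0
    then show ?thesis using Cons.prems(1) by auto
  next
    case (Suc m)
    from Cons.prems(3) have x: "erasable (residual n (inversions n w)) \<theta> x"
      and xs: "peeling_sequence (pre_digraph.del_vert (residual n (inversions n w)) x)
        (erase_value (residual n (inversions n w)) \<theta> x) xs"
      by (auto elim: peeling_sequence.cases)
    from erase_step[OF Cons.prems(1,2) x] obtain v where v: "v permutes {1..n}"
      "inversions n v = insert x (inversions n w)"
      "values_at n v (erase_value (residual n (inversions n w)) \<theta> x)"
      "pre_digraph.del_vert (residual n (inversions n w)) x = residual n (inversions n v)" .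
    from Cons.IH[OF v(1,3) xs[unfolded v(4)], of m] show ?thesis
      using v(2) Suc by simp
  qed
qed

text \<open>The ascents of a chain from \<open>w\<close> to \<open>\<tau>\<close> are erased in
  turn. The value function is quantified inside the claim because each erasure changes it.\<close>

lemma inversions_peeling_prefix:
  assumes "w permutes {1..n}" "\<tau> permutes {1..n}" "inversions n w \<subseteq> inversions n \<tau>"
  shows "\<forall>\<theta>. values_at n w \<theta> \<longrightarrow>
    (\<exists>k xs. peeling_sequence (residual n (inversions n w)) \<theta> xs \<and> k \<le> length xs \<and>
      inversions n \<tau> = inversions n w \<union> set (take k xs))"
  using assms
proof (induction rule: ascent_chain_induct)
  case refl
  \<comment> \<open>The prefix is empty here, but a peeling sequence must still continue from
    \<open>\<tau>\<close> until no vertex is erasable.\<close>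
  show ?case
    using peeling_sequence_exists[OF assms(2)] by (metis le0 list.set(1) sup_bot_right take0)
next
  case (step w j)
  show ?case
  proof (intro allI impI)
    fix \<theta> assume vals: "values_at n w \<theta>"
    let ?x = "(w j, w (j + 1))"
    let ?R = "residual n (inversions n w)"
    note insert = inversions_ascent(1)[OF step.hyps(1,2)]
    have x: "erasable ?R \<theta> ?x"
      using step.hyps(1) vals step.hyps(2) by (rule ascent_erasable)
    from step.IH values_at_erase[OF step.hyps(1,2) vals] obtain k xs
      where xs: "peeling_sequence (residual n (insert ?x (inversions n w))) (erase_value ?R \<theta> ?x) xs"
        and k: "k \<le> length xs"
        and eq: "inversions n \<tau> = insert ?x (inversions n w) \<union> set (take k xs)"
      unfolding insert by blast
    from peeling_sequence.erase[OF x] xs have "peeling_sequence ?R \<theta> (?x # xs)"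
      by (simp add: del_vert_residual)
    then show "\<exists>k xs. peeling_sequence ?R \<theta> xs \<and> k \<le> length xs \<and>
        inversions n \<tau> = inversions n w \<union> set (take k xs)"
      using k eq by (intro exI[of _ "Suc k"] exI[of _ "?x # xs"]) auto
  qed
qed

section \<open>The isomorphism with the erased sets\<close>

lemma IS_lambda_eq_inversions:
  "IS (lambda_digraph n) lambda_value = inversions n ` {w. w permutes {1..n}}"
proof
  note init = values_at_id[of n] residual_empty[of n] inversions_id[of n]
  show "IS (lambda_digraph n) lambda_value \<subseteq> inversions n ` {w. w permutes {1..n}}"
  proof
    fix I assume "I \<in> IS (lambda_digraph n) lambda_value"
    then consider "I = {}" |
      k xs where "I = set (take k xs)" "peeling_sequence (lambda_digraph n) lambda_value xs"
      by (auto simp: IS_def)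
    then show "I \<in> inversions n ` {w. w permutes {1..n}}"
    proof cases
      case 1
      then show ?thesis
        using inversions_id permutes_id by (intro image_eqI[of _ _ id]) auto
    next
      case 2
      then show ?thesis
        using peeling_prefix_inversions[OF permutes_id, of n lambda_value xs k]
        by (auto simp: init)
    qed
  qed
  show "inversions n ` {w. w permutes {1..n}} \<subseteq> IS (lambda_digraph n) lambda_value"
  proof clarify
    fix w :: "nat \<Rightarrow> nat" assume "w permutes {1..n}"
    from inversions_peeling_prefix[OF permutes_id this] have
      "\<exists>k xs. peeling_sequence (lambda_digraph n) lambda_value xs \<and> k \<le> length xs \<and>
        inversions n w = set (take k xs)"
      using values_at_id unfolding init by auto
    then obtain k xs where "peeling_sequence (lambda_digraph n) lambda_value xs" "k \<le> length xs"
        "inversions n w = set (take k xs)"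
      by blast
    then show "inversions n w \<in> IS (lambda_digraph n) lambda_value"
      \<comment> \<open>For \<open>k = 0\<close> the set is empty, which \<open>IS\<close> contains
        by its separate \<open>insert {}\<close>.\<close>
      unfolding IS_def by (cases k) auto
  qed
qed

theorem theorem4:
  fixes n :: nat
  assumes "n \<ge> 2"
  shows "\<exists>f. bij_betw f {w. w permutes {1..n}} (IS (lambda_digraph n) lambda_value) \<and>
    (\<forall>w \<tau>. w permutes {1..n} \<longrightarrow> \<tau> permutes {1..n} \<longrightarrow>
       (right_weak_le n w \<tau> \<longleftrightarrow> f w \<subseteq> f \<tau>))"
proof (intro exI conjI)
  show "bij_betw (inversions n) {w. w permutes {1..n}} (IS (lambda_digraph n) lambda_value)"
    unfolding bij_betw_def IS_lambda_eq_inversions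
    by (auto intro!: inj_onI inversions_inj)
  show "\<forall>w \<tau>. w permutes {1..n} \<longrightarrow> \<tau> permutes {1..n} \<longrightarrow>
       (right_weak_le n w \<tau> \<longleftrightarrow> inversions n w \<subseteq> inversions n \<tau>)"
    using right_weak_le_iff_inversions by blast
qed

end
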